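(* Let $m\ge 2$ be an integer, let $\{a_1,\ldots,a_{m-1}\}$ be a $3$-distributable multiset of positive integers, and let $S=\sum_{i=1}^{m-1}a_i$. Let $c$ be an integer with $c\in\bigcup_{3\le\lambda\le\lceil (S+1)/2\rceil}\big(\lambda(S-1),\lambda S\big)$ (union over integers $\lambda$), and let $cS$ be even. If $c=\lambda S-\mu$ with integers $\lambda,\mu$ satisfying $3\le\lambda\le\left\lceil\frac{S+1}{2}\right\rceil$ and $1\le\mu\le\lambda-1$, then $$\mathrm{Rad}_2(a_1,\ldots,a_{m-1},-1;c)\le 2\lambda-\mu.$$
   Context: For nonzero integers $b_1,\ldots,b_m$, an integer $c$ and an integer $r\ge 2$, the Rado number $\mathrm{Rad}_r(b_1,\ldots,b_m;c)$ is the least positive integer $N$ such that for every colouring $\chi:\{1,\ldots,N\}\to\{1,\ldots,r\}$ there exist $x_1,\ldots,x_m\in\{1,\ldots,N\}$ (not necessarily distinct) with $\sum_{i=1}^m b_ix_i=c$ and $\chi(x_1)=\cdots=\chi(x_m)$. Thus $\mathrm{Rad}_2(a_1,\ldots,a_{m-1},-1;c)$ refers to the equation $\sum_{i=1}^{m-1}a_ix_i-x_m=c$. An upper bound by a finite number includes the assertion that the Rado number exists. A multiset $\{a_1,\ldots,a_k\}$ of positive integers is $t$-distributable ($t$ a positive integer) if for every choice of nonnegative integers $\sigma_1,\ldots,\sigma_t$ with $\sum_{j=1}^t\sigma_j=\sum_{i=1}^k a_i$ there is a partition of the index set $\{1,\ldots,k\}$ into pairwise disjoint sets $S_1,\ldots,S_t$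 (some possibly empty) such that $\sum_{i\in S_j}a_i=\sigma_j$ for every $j\in\{1,\ldots,t\}$. *)

theory Defs
  imports Complex_Main "HOL-Library.Extended_Nat" "HOL-Library.FuncSet" "HOL-Library.Disjoint_Sets"
begin

definition mono_solvable :: "nat \<Rightarrow> int list \<Rightarrow> int \<Rightarrow> nat \<Rightarrow> bool" where
  "mono_solvable r bs c N \<longleftrightarrow>
     (\<forall>\<chi> \<in> {1..N} \<rightarrow> {1..r}.
        \<exists>xs :: nat list. length xs = length bs \<and> set xs \<subseteq> {1..N} \<and>
          (\<Sum>i<length bs. bs ! i * int (xs ! i)) = c \<and>
          (\<exists>k. \<forall>x \<in> set xs. \<chi> x = k))"

text \<open>The infimum is taken in the extended naturals: it is the least such \<open>N\<close> if there is one,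
  and \<open>\<infinity>\<close> otherwise. Hence a finite upper bound includes the existence of the Rado number.\<close>

definition rado_number :: "nat \<Rightarrow> int list \<Rightarrow> int \<Rightarrow> enat" where
  "rado_number r bs c = Inf {enat N | N. 1 \<le> N \<and> mono_solvable r bs c N}"

text \<open>The multiset is represented by a list enumerating it; the order of the entries is irrelevant.\<close>

definition distributable :: "nat \<Rightarrow> nat list \<Rightarrow> bool" where
  "distributable t a \<longleftrightarrow>
     (\<forall>\<sigma> :: nat \<Rightarrow> nat. (\<Sum>j=1..t. \<sigma> j) = sum_list a \<longrightarrow>
        (\<exists>P :: nat \<Rightarrow> nat set.
           disjoint_family_on P {1..t} \<and> (\<Union>j\<in>{1..t}. P j) = {..<length a} \<and>
           (\<forall>j\<in>{1..t}. (\<Sum>i\<in>P j. a ! i) = \<sigma> j)))"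

end

theory Submission
  imports Defs
begin

text \<open>
  Put \<open>d = \<lambda> - \<mu>\<close> and write every value as \<open>\<lambda> + p\<close>, so that \<open>p\<close> ranges over \<open>{1 - \<lambda>..d}\<close>.
  By distributability, weights \<open>\<sigma>\<^sub>j\<close> with sum \<open>S\<close> can be placed at will on three offsets \<open>p\<^sub>j\<close>, and the
  equation becomes \<open>(\<Sum>j. \<sigma>\<^sub>j * p\<^sub>j) = s + d\<close>, where \<open>s\<close> is the offset of the last variable.
  Only the offsets \<open>0\<close>, \<open>1\<close>, \<open>d\<close> and \<open>-d\<close> matter.
  If one of \<open>1\<close>, \<open>d\<close>, \<open>-d\<close> has the colour of \<open>0\<close>, there is a solution in that colour:
  \<open>(d + 1) * 1 = 1 + d\<close>, or \<open>2 * d = d + d\<close>, or \<open>0 = -d + d\<close>, with the remaining weight put on \<open>0\<close>.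
  Otherwise \<open>1\<close>, \<open>d\<close>, \<open>-d\<close> all have the other of the two colours. Take \<open>s = -d\<close>, so that the weighted
  sum has to vanish. For even \<open>S\<close> this is achieved by splitting the weight equally between
  \<open>d\<close> and \<open>-d\<close>. For odd \<open>S\<close> the parity hypothesis makes \<open>d\<close> even, so \<open>S - d\<close> is odd; weight
  \<open>d\<close> on the offset \<open>1\<close> then compensates for one more unit of weight on \<open>-d\<close> than on \<open>d\<close>.
  The bound on \<open>\<lambda>\<close> gives \<open>2 * d \<le> S\<close>, which keeps all these weights nonnegative.
\<close>

text \<open>Giving \<open>x\<^sub>i\<close> the value of the block containing \<open>i\<close> turns a weighted sum of \<open>t\<close>
  values into a value of the left-hand side of the equation.\<close>

lemma distributable_weighted_sum:
  fixes v \<sigma> :: "nat \<Rightarrow> nat"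
  assumes "distributable t a" and "(\<Sum>j=1..t. \<sigma> j) = sum_list a"
  obtains xs where "length xs = length a" "set xs \<subseteq> v ` {1..t}"
    "(\<Sum>i<length a. a ! i * xs ! i) = (\<Sum>j=1..t. \<sigma> j * v j)"
proof -
  obtain P where disj: "disjoint_family_on P {1..t}"
    and cover: "(\<Union>j\<in>{1..t}. P j) = {..<length a}"
    and weight: "\<And>j. j \<in> {1..t} \<Longrightarrow> (\<Sum>i\<in>P j. a ! i) = \<sigma> j"
    using assms unfolding distributable_def by meson
  have "\<forall>i\<in>{..<length a}. \<exists>j. j \<in> {1..t} \<and> i \<in> P j"
    using cover by blast
  then obtain b where b: "\<And>i. i < length a \<Longrightarrow> b i \<in> {1..t} \<and> i \<in> P (b i)"
    by (metis lessThan_iff)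
  have block: "b i = j" if "j \<in> {1..t}" "i \<in> P j" for i j
  proof -
    have "i < length a"
      using that cover by blast
    with b that disj show ?thesis
      unfolding disjoint_family_on_def by blast
  qed
  define xs where "xs = map (\<lambda>i. v (b i)) [0..<length a]"
  have "(\<Sum>i<length a. a ! i * xs ! i) = (\<Sum>i<length a. a ! i * v (b i))"
    by (intro sum.cong) (auto simp: xs_def)
  also have "\<dots> = (\<Sum>i\<in>(\<Union>j\<in>{1..t}. P j). a ! i * v (b i))"
    using cover by simp
  also have "\<dots> = (\<Sum>j=1..t. \<Sum>i\<in>P j. a ! i * v (b i))"
  proof (rule sum.UNION_disjoint)
    show "\<forall>j\<in>{1..t}. finite (P j)"
      using cover finite_subset[OF _ finite_lessThan] by blast
    show "\<forall>j\<in>{1..t}. \<forall>k\<in>{1..t}. j \<noteq> k \<longrightarrow> P j \<inter> P k = {}"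
      using disj unfolding disjoint_family_on_def by blast
  qed simp
  also have "\<dots> = (\<Sum>j=1..t. \<sigma> j * v j)"
  proof (rule sum.cong[OF refl])
    fix j assume j: "j \<in> {1..t}"
    have "(\<Sum>i\<in>P j. a ! i * v (b i)) = (\<Sum>i\<in>P j. a ! i * v j)"
      using block[OF j] by simp
    also have "\<dots> = \<sigma> j * v j"
      using weight[OF j] by (simp flip: sum_distrib_right)
    finally show "(\<Sum>i\<in>P j. a ! i * v (b i)) = \<sigma> j * v j" .
  qed
  finally have "(\<Sum>i<length a. a ! i * xs ! i) = (\<Sum>j=1..t. \<sigma> j * v j)" .
  moreover have "length xs = length a" "set xs \<subseteq> v ` {1..t}"
    using b by (auto simp: xs_def)
  ultimately show thesis
    using that by blast
qed

text \<open>This reduces the search for a monochromatic solution to a choice of three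
  weights, three values and a value \<open>z\<close> of the last variable.\<close>

lemma solution_of_weights:
  fixes p q r :: nat
  assumes dist: "distributable 3 a" and total: "p + q + r = sum_list a"
    and range: "{u, v, w, z} \<subseteq> {1..N}"
    and eq: "int (p * u + q * v + r * w) - int z = c"
    and mono: "\<chi> u = \<chi> z" "\<chi> v = \<chi> z" "\<chi> w = \<chi> z"
  defines "bs \<equiv> map int a @ [-1]"
  shows "\<exists>xs :: nat list. length xs = length bs \<and> set xs \<subseteq> {1..N} \<and>
          (\<Sum>i<length bs. bs ! i * int (xs ! i)) = c \<and> (\<exists>k. \<forall>x \<in> set xs. \<chi> x = k)"
proof -
  define f where "f x y w j = (if j = 1 then x else if j = 2 then y else w)" for x y w j :: nat
  have three: "{1..3::nat} = {1, 2, 3}"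
    by auto
  have "(\<Sum>j=1..3. f p q r j) = sum_list a"
    using total unfolding three f_def by simp
  then obtain xs where len: "length xs = length a" and sub: "set xs \<subseteq> f u v w ` {1..3}"
    and sum: "(\<Sum>i<length a. a ! i * xs ! i) = (\<Sum>j=1..3. f p q r j * f u v w j)"
    using distributable_weighted_sum[OF dist] by metis
  have sub': "set xs \<subseteq> {u, v, w}"
    using sub unfolding three f_def by auto
  have "(\<Sum>i<length bs. bs ! i * int ((xs @ [z]) ! i))
      = (\<Sum>i<length a. bs ! i * int ((xs @ [z]) ! i)) - int z"
    using len by (simp add: bs_def nth_append)
  also have "(\<Sum>i<length a. bs ! i * int ((xs @ [z]) ! i)) = int (\<Sum>i<length a. a ! i * xs ! i)"
    unfolding of_nat_sum using len by (intro sum.cong) (auto simp: bs_def nth_append)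
  also have "\<dots> = int (p * u + q * v + r * w)"
    using sum unfolding three f_def by simp
  finally have "(\<Sum>i<length bs. bs ! i * int ((xs @ [z]) ! i)) = c"
    using eq by simp
  moreover have "length (xs @ [z]) = length bs"
    using len by (simp add: bs_def)
  moreover have "set (xs @ [z]) \<subseteq> {1..N}"
    using sub' range by auto
  moreover have "\<forall>x\<in>set (xs @ [z]). \<chi> x = \<chi> z"
    using sub' mono by auto
  ultimately show ?thesis
    by blast
qed

text \<open>The values \<open>l\<close>, \<open>l + 1\<close>, \<open>l + d\<close>, \<open>l - d\<close> are the offsets \<open>0\<close>, \<open>1\<close>, \<open>d\<close>, \<open>-d\<close> from above.
  With two colours, either one of the last three agrees with \<open>l\<close> or all three agree with each other,
  and each possibility has its own choice of weights.\<close>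

lemma mono_solvable_of_distributable:
  fixes l d S :: nat
  assumes dist: "distributable 3 a" and S_def: "S = sum_list a"
    and d: "1 \<le> d" "d < l" "2 * d \<le> S"
    and parity: "even S \<or> even d"
  shows "mono_solvable 2 (map int a @ [-1]) (int l * int S - int (l - d)) (l + d)"
  unfolding mono_solvable_def
proof (rule ballI, goal_cases)
  case (1 \<chi>)
  have S: "2 \<le> S" "d + 1 \<le> S"
    using d by auto
  have mem: "l \<in> {1..l+d}" "l + 1 \<in> {1..l+d}" "l + d \<in> {1..l+d}" "l - d \<in> {1..l+d}"
    using d by auto
  have colours: "\<chi> x = 1 \<or> \<chi> x = 2" if "x \<in> {1..l+d}" for x
    using funcset_mem[OF 1 that] by auto
  note sol = solution_of_weights[OF dist, folded S_def, where N = "l + d" and \<chi> = \<chi>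
      and c = "int l * int S - int (l - d)"]
  obtain e where e: "l = e + d"
    using d by (metis le_add_diff_inverse2 less_imp_le)
  consider "\<chi> (l - d) = \<chi> l" | "\<chi> (l + d) = \<chi> l" | "\<chi> (l + 1) = \<chi> l"
    | "\<chi> (l + d) = \<chi> (l - d)" "\<chi> (l + 1) = \<chi> (l - d)"
    using colours mem by metis
  then show ?case
  proof cases
    case 1
    then show ?thesis
      using mem by (intro sol[of S 0 0 l l l "l - d"]) auto
  next
    case 2
    obtain k where k: "S = k + 2"
      using S(1) by (metis le_add_diff_inverse2)
    from 2 show ?thesis
      using mem
      by (intro sol[of 2 k 0 "l + d" l l "l + d"]) (auto simp: k e algebra_simps)
  next
    case 3
    obtain k where k: "S = k + (d + 1)"
      using S(2) by (metis le_add_diff_inverse2)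
    from 3 show ?thesis
      using mem
      by (intro sol[of "d + 1" k 0 "l + 1" l l "l + 1"]) (auto simp: k e algebra_simps)
  next
    case 4
    show ?thesis
    proof (cases "even S")
      case True
      then obtain k where k: "S = k + k"
        by (metis evenE mult_2)
      from 4 show ?thesis
        using mem
        by (intro sol[of k k 0 "l + d" "l - d" "l - d" "l - d"])
           (auto simp: k e algebra_simps)
    next
      case False
      then have "odd (S - d)"
        using parity S by simp
      then obtain k where "S - d = 2 * k + 1"
        by (elim oddE)
      \<comment> \<open>offsets \<open>1\<close>, \<open>d\<close>, \<open>-d\<close>: the weighted sum is \<open>d * 1 + k * d - (k + 1) * d = 0\<close>\<close>
      then have k: "S = d + (k + (k + 1))"
        using S by simp
      from 4 show ?thesis
        using mem
        by (intro sol[of d k "k + 1" "l + 1" "l + d" "l - d" "l - d"])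
           (auto simp: k e algebra_simps)
    qed
  qed
qed

theorem theorem14:
  fixes m :: nat and a :: "nat list" and S c l \<mu> :: int
  assumes "m \<ge> 2"
    and "length a = m - 1"
    and "\<forall>x \<in> set a. x > 0"
    and "distributable 3 a"
    and "S = int (sum_list a)"
    and "c \<in> (\<Union>k \<in> {3..\<lceil>(real_of_int S + 1) / 2\<rceil>}. {k * (S - 1)<..<k * S})"
    and "even (c * S)"
    and "c = l * S - \<mu>"
    and "3 \<le> l" and "l \<le> \<lceil>(real_of_int S + 1) / 2\<rceil>"
    and "1 \<le> \<mu>" and "\<mu> \<le> l - 1"
  shows "rado_number 2 (map int a @ [-1]) c \<le> enat (nat (2 * l - \<mu>))"
proof -
  define L where "L = nat l"
  define d where "d = nat (l - \<mu>)"
  have L: "int L = l" and d: "int d = l - \<mu>"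
    using assms by (auto simp: L_def d_def)
  have "real_of_int l < (real_of_int S + 1) / 2 + 1"
    using assms(10) by linarith
  then have "real_of_int (2 * l) < real_of_int (S + 3)"
    by (simp add: field_simps)
  then have l_S: "2 * l \<le> S + 2"
    unfolding of_int_less_iff by linarith
  have "even S \<or> even (l - \<mu>)"
    using assms(7,8) by auto
  then have parity: "even (sum_list a) \<or> even d"
    using assms(5) d by (metis even_of_nat_iff)
  have bounds: "1 \<le> d" "d < L" "2 * d \<le> sum_list a"
    using L d l_S assms(5,9,11,12) by linarith+
  have diff: "int (L - d) = \<mu>"
    using L d bounds by simp
  have N: "L + d = nat (2 * l - \<mu>)"
    using L d by linarith
  have "mono_solvable 2 (map int a @ [-1]) c (nat (2 * l - \<mu>))"
    using mono_solvable_of_distributable[OF assms(4) refl bounds parity]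
    unfolding diff L N assms(5)[symmetric] assms(8) .
  moreover have "1 \<le> nat (2 * l - \<mu>)"
    using assms(9,12) by linarith
  ultimately show ?thesis
    unfolding rado_number_def by (intro Inf_lower) blast
qed

end
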